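(* Let $(c,c_F)$ be an isothermic congruence in $\mathbf{L}^3$, let $\mathring p(v)\in\mathbf{E}^2\simeq\mathbb{C}$ be the orthogonal projection onto $\mathbf{E}^2$ of the center of $c(v)$ for $v\in\mathbb{Z}^2$, and let $$X(v) = -\frac{(\mathring p(v+e_1)-\mathring p(v))(\mathring p(v-e_1)-\mathring p(v))}{(\mathring p(v+e_2)-\mathring p(v))(\mathring p(v-e_2)-\mathring p(v))}$$ be the (real) $X$-variables, assumed to satisfy $X(v)>0$ for all $v\in\mathbb{Z}^2$. For each white vertex $w$ put $$Y(w)=X(w)^{-1}\,\frac{(1+X(w+e_2))(1+X(w-e_2))}{(1+X(w+e_1)^{-1})(1+X(w-e_1)^{-1})}.$$ Then for every black vertex $b$, $$X(b)^2=\frac{(1+X(b+e_2))(1+X(b-e_2))}{(1+X(b+e_1)^{-1})(1+X(b-e_1)^{-1})}$$ and $$X(b)^2=\frac{(1+Y(b+e_2))(1+Y(b-e_2))}{(1+Y(b+e_1)^{-1})(1+Y(b-e_1)^{-1})}.$$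
   Context: $\mathbb{Z}^2$ is the vertex set of the square lattice graph, $F(\mathbb{Z}^2)$ its set of unit square faces, $e_1,e_2$ the standard basis. Black vertices: $z_1+z_2$ even; white vertices: $z_1+z_2$ odd. Lorentz space $\mathbf{L}^3$ is $\mathbb{R}^3$ with $\langle x,y\rangle = x_1y_1+x_2y_2-x_3y_3$; $\mathbf{E}^2=\{x_3=0\}$, identified with $\mathbb{C}$ via $x_1+ix_2$; the orthogonal projection onto $\mathbf{E}^2$ forgets $x_3$. A plane is spacelike if the form restricted to its direction space is positive definite. Oriented spheres: an oriented timelike sphere has center $m$ and signed radius $r\ne0$; its point set is $\{x:\langle x-m,x-m\rangle=r^2\}$ (outward oriented if $r>0$, inward if $r<0$). A null-sphere with center $m$ is $\{x:\langle x-m,x-m\rangle=0\}$. An isotropic line is $L=\{q+td\}$ with $d\ne0$, $\langle d,d\rangle=0$; it lies in the unique isotropic plane $H_L=\{x:\langle x-q,d\rangle=0\}$. An orientation of $L$ is the choice of a component $\Omega$ of $H_L\setminus L$. A null-sphere is in contact with $(L,\Omega)$ iff its center lies on $L$. An oriented timelike sphere $(m,r)$ is in contact with $(L,\Omega)$ iff it contains $L$ (forcing $m\in H_L\setminus L$) and $m\notin\Omega$ if $r>0$, $m\in\Omega$ if $r<0$. A contact congruence is a pair of maps $c$ (from $\mathbb{Z}^2$ to oriented timelike spheres and null-spheres) and $c_F$ (from $F(\mathbb{Z}^2)$ to oriented isotropic lines) with $c(v)$ in oriented contact with $c_F(f)$ whenever $v,f$ are incident. It is a null congruence if $c(b)$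 is a null-sphere for every black $b$ and $c(w)$ is an oriented timelike sphere for every white $w$. An isothermic congruence is a null congruence such that for each black vertex $b$ the centers of the four white spheres $c(b\pm e_1)$, $c(b\pm e_2)$ lie in a spacelike plane. Nondegeneracy (generic position) assumptions: any three cyclically consecutive ones among those four centers are non-collinear; $\mathring p(v)\ne\mathring p(v')$ for adjacent $v,v'$; and $c_F(f)\neq c_F(f')$ for faces $f,f'$ sharing an edge. *)

theory Defs
  imports "HOL-Analysis.Analysis"
begin

section \<open>The square lattice\<close>

type_synonym vertex = "int \<times> int"

definition e1 :: vertex where "e1 = (1, 0)"
definition e2 :: vertex where "e2 = (0, 1)"

definition black :: "vertex \<Rightarrow> bool" where
  "black v \<longleftrightarrow> even (fst v + snd v)"

definition white :: "vertex \<Rightarrow> bool" where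
  "white v \<longleftrightarrow> odd (fst v + snd v)"

definition adjacent :: "vertex \<Rightarrow> vertex \<Rightarrow> bool" where
  "adjacent v v' \<longleftrightarrow> v' \<in> {v + e1, v - e1, v + e2, v - e2}"

text \<open>A face is represented by the set of the four vertices incident with it.\<close>

definition faces :: "vertex set set" where
  "faces = {{z, z + e1, z + e1 + e2, z + e2} | z. True}"

definition share_edge :: "vertex set \<Rightarrow> vertex set \<Rightarrow> bool" where
  "share_edge f f' \<longleftrightarrow> f \<noteq> f' \<and> (\<exists>v v'. adjacent v v' \<and> {v, v'} \<subseteq> f \<inter> f')"


section \<open>Lorentz space\<close>

definition lorentz :: "real ^ 3 \<Rightarrow> real ^ 3 \<Rightarrow> real" where
  "lorentz x y = x $ 1 * y $ 1 + x $ 2 * y $ 2 - x $ 3 * y $ 3"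

definition proj_E2 :: "real ^ 3 \<Rightarrow> complex" where
  "proj_E2 x = Complex (x $ 1) (x $ 2)"

definition spacelike_plane :: "(real ^ 3) set \<Rightarrow> bool" where
  "spacelike_plane P \<longleftrightarrow>
     (\<exists>q V. subspace V \<and> dim V = 2 \<and> P = (\<lambda>x. q + x) ` V \<and>
            (\<forall>x\<in>V. x \<noteq> 0 \<longrightarrow> 0 < lorentz x x))"

text \<open>In \<open>Timelike_sphere m r\<close> the signed radius \<open>r\<close> is required to be nonzero,
  see \<open>is_timelike_sphere\<close>.\<close>

datatype lsphere =
    Null_sphere (center: "real ^ 3")
  | Timelike_sphere (center: "real ^ 3") real

definition is_null_sphere :: "lsphere \<Rightarrow> bool" where
  "is_null_sphere s \<longleftrightarrow> (\<exists>m. s = Null_sphere m)"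

definition is_timelike_sphere :: "lsphere \<Rightarrow> bool" where
  "is_timelike_sphere s \<longleftrightarrow> (\<exists>m r. r \<noteq> 0 \<and> s = Timelike_sphere m r)"

fun sphere_points :: "lsphere \<Rightarrow> (real ^ 3) set" where
  "sphere_points (Null_sphere m) = {x. lorentz (x - m) (x - m) = 0}"
| "sphere_points (Timelike_sphere m r) = {x. lorentz (x - m) (x - m) = r\<^sup>2}"

text \<open>An oriented isotropic line is a pair \<open>(L, \<Omega>)\<close> of a line and a connected component of the
  complement of \<open>L\<close> in the isotropic plane \<open>H\<close> through \<open>L\<close>; \<open>H\<close> does not depend on the
  parametrisation of \<open>L\<close>.\<close>

type_synonym oriented_line = "(real ^ 3) set \<times> (real ^ 3) set"

definition oriented_isotropic_line :: "oriented_line \<Rightarrow> bool" where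
  "oriented_isotropic_line l \<longleftrightarrow>
     (\<exists>q d L H. d \<noteq> 0 \<and> lorentz d d = 0 \<and>
        L = {q + t *\<^sub>R d | t. True} \<and> H = {x. lorentz (x - q) d = 0} \<and>
        fst l = L \<and> snd l \<in> components (H - L))"

fun in_contact :: "lsphere \<Rightarrow> oriented_line \<Rightarrow> bool" where
  "in_contact (Null_sphere m) (L, \<Omega>) \<longleftrightarrow> m \<in> L"
| "in_contact (Timelike_sphere m r) (L, \<Omega>) \<longleftrightarrow>
     L \<subseteq> sphere_points (Timelike_sphere m r) \<and>
     (0 < r \<longrightarrow> m \<notin> \<Omega>) \<and> (r < 0 \<longrightarrow> m \<in> \<Omega>)"


section \<open>Congruences\<close>

definition contact_congruence ::
    "(vertex \<Rightarrow> lsphere) \<Rightarrow> (vertex set \<Rightarrow> oriented_line) \<Rightarrow> bool" where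
  "contact_congruence c cF \<longleftrightarrow>
     (\<forall>v. is_null_sphere (c v) \<or> is_timelike_sphere (c v)) \<and>
     (\<forall>f\<in>faces. oriented_isotropic_line (cF f)) \<and>
     (\<forall>f\<in>faces. \<forall>v\<in>f. in_contact (c v) (cF f))"

definition null_congruence ::
    "(vertex \<Rightarrow> lsphere) \<Rightarrow> (vertex set \<Rightarrow> oriented_line) \<Rightarrow> bool" where
  "null_congruence c cF \<longleftrightarrow>
     contact_congruence c cF \<and>
     (\<forall>b. black b \<longrightarrow> is_null_sphere (c b)) \<and>
     (\<forall>w. white w \<longrightarrow> is_timelike_sphere (c w))"

definition isothermic_congruence ::
    "(vertex \<Rightarrow> lsphere) \<Rightarrow> (vertex set \<Rightarrow> oriented_line) \<Rightarrow> bool" where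
  "isothermic_congruence c cF \<longleftrightarrow>
     null_congruence c cF \<and>
     (\<forall>b. black b \<longrightarrow>
        (\<exists>P. spacelike_plane P \<and>
             {center (c (b + e1)), center (c (b + e2)),
              center (c (b - e1)), center (c (b - e2))} \<subseteq> P))"

definition nondegenerate ::
    "(vertex \<Rightarrow> lsphere) \<Rightarrow> (vertex set \<Rightarrow> oriented_line) \<Rightarrow> bool" where
  "nondegenerate c cF \<longleftrightarrow>
     (\<forall>b. black b \<longrightarrow>
        \<not> collinear {center (c (b + e1)), center (c (b + e2)), center (c (b - e1))} \<and>
        \<not> collinear {center (c (b + e2)), center (c (b - e1)), center (c (b - e2))} \<and>
        \<not> collinear {center (c (b - e1)), center (c (b - e2)), center (c (b + e1))} \<and>
        \<not> collinear {center (c (b - e2)), center (c (b + e1)), center (c (b + e2))}) \<and>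
     (\<forall>v v'. adjacent v v' \<longrightarrow> proj_E2 (center (c v)) \<noteq> proj_E2 (center (c v'))) \<and>
     (\<forall>f\<in>faces. \<forall>f'\<in>faces. share_edge f f' \<longrightarrow> cF f \<noteq> cF f')"

end

theory Submission
  imports Defs
begin

text \<open>Put \<open>\<tau> v = h v + \<i> r v\<close>, where \<open>h v\<close> is the third coordinate of the center of \<open>c v\<close> and
  \<open>r v\<close> its signed radius (\<open>0\<close> at black vertices). A face carries a line with direction
  \<open>(u, 1)\<close>, \<open>\<bar>u\<bar> = 1\<close>, and each edge \<open>vn\<close> of the face satisfies \<open>p n - p v = (\<tau> n - \<tau> v) u\<close>, or
  the same with \<open>\<tau> n - \<tau> v\<close> conjugated, depending on the orientation of the line. The orientation
  alternates between adjacent faces, so \<open>X v\<close> is real and equals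
  \<open>- (\<tau>\<^sub>E - \<tau> v) (\<tau>\<^sub>W - \<tau> v) / ((\<tau>\<^sub>N - \<tau> v) (\<tau>\<^sub>S - \<tau> v))\<close>, with the four neighbours of \<open>v\<close> as indices.

  At a white vertex the quadratic \<open>(T - \<tau>\<^sub>E) (T - \<tau>\<^sub>W) + X (T - \<tau>\<^sub>N) (T - \<tau>\<^sub>S)\<close> in \<open>T\<close> is real with
  the nonreal root \<open>\<tau> w\<close>, hence equals \<open>(1 + X) \<bar>T - \<tau> w\<bar>\<^sup>2\<close> for real \<open>T\<close>. Evaluating it at
  \<open>T = \<tau> b\<close> for the four neighbours \<open>w\<close> of \<open>b\<close>, the left-hand sides cancel in the product formula
  and \<open>\<Prod> \<bar>\<tau> w - \<tau> b\<bar>\<^sup>2\<close> (with exponents \<open>\<plusminus>\<close>) is left, which is \<open>X b\<^sup>2\<close>.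

  At a black vertex the corresponding quadratic has the root \<open>\<tau> b\<close> and a second root \<open>\<sigma> b\<close>. Being
  isothermic makes \<open>\<sigma> b\<close> real, since it forces \<open>r\<^sub>E + r\<^sub>W + X (r\<^sub>N + r\<^sub>S) = 0\<close>. Evaluating
  the black quadratics at \<open>\<tau> w\<close> shows that \<open>Y w\<close> is related to \<open>\<sigma>\<close> as \<open>X w\<close> is to \<open>\<tau>\<close>, and the first
  argument applies again.\<close>

section \<open>Oriented isotropic lines\<close>

text \<open>A nonzero isotropic vector has nonzero third coordinate, so every isotropic direction
  can be scaled to this form; it is isotropic exactly when \<open>norm u = 1\<close>.\<close>

definition null_dir :: "complex \<Rightarrow> real ^ 3" where
  "null_dir u = vector [Re u, Im u, 1]"

text \<open>For \<open>norm u = 1\<close>, on vectors Lorentz-orthogonal to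
  \<open>null_dir u\<close> the form reduces to the square of \<open>side u\<close>, and the line is
  where \<open>side u\<close> vanishes. So \<open>side u\<close> tells the two half-planes
  apart.\<close>

definition side :: "complex \<Rightarrow> real ^ 3 \<Rightarrow> real" where
  "side u x = Im (cnj u * proj_E2 x)"

text \<open>The half-plane is chosen such that an oriented timelike sphere with center \<open>m'\<close> and signed
  radius \<open>r\<close> in contact with the line satisfies \<open>side u (m' - m) = \<epsilon> * r\<close>.\<close>

definition oline :: "real ^ 3 \<Rightarrow> complex \<Rightarrow> real \<Rightarrow> oriented_line" where
  "oline m u \<epsilon> = ({m + t *\<^sub>R null_dir u | t. True},
                   {x. lorentz (x - m) (null_dir u) = 0 \<and> \<epsilon> * side u (x - m) < 0})"

lemma null_dir_nth [simp]:
  "null_dir u $ 1 = Re u" "null_dir u $ 2 = Im u" "null_dir u $ 3 = 1"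
  by (simp_all add: null_dir_def)

lemma proj_E2_simps:
  "proj_E2 (x + y) = proj_E2 x + proj_E2 y" "proj_E2 (x - y) = proj_E2 x - proj_E2 y"
  "proj_E2 (s *\<^sub>R x) = s *\<^sub>R proj_E2 x" "proj_E2 (null_dir u) = u"
  by (simp_all add: proj_E2_def complex_eq_iff)

lemma vec3_eq_iff: "x = y \<longleftrightarrow> proj_E2 x = proj_E2 y \<and> x $ 3 = y $ 3" for x y :: "real ^ 3"
  by (auto simp: vec_eq_iff forall_3 proj_E2_def complex_eq_iff)

lemma lorentz_null_dir: "lorentz x (null_dir u) = Re (cnj u * proj_E2 x) - x $ 3"
  by (simp add: lorentz_def proj_E2_def algebra_simps)

lemma lorentz_self: "lorentz x x = (cmod (proj_E2 x))\<^sup>2 - (x $ 3)\<^sup>2"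
  by (simp add: lorentz_def proj_E2_def cmod_def power2_eq_square)

lemma lorentz_linear:
  "lorentz (x + y) z = lorentz x z + lorentz y z" "lorentz (x - y) z = lorentz x z - lorentz y z"
  "lorentz (s *\<^sub>R x) z = s * lorentz x z" "lorentz x (s *\<^sub>R z) = s * lorentz x z"
  by (simp_all add: lorentz_def algebra_simps)

text \<open>Tangency says that \<open>cnj u * proj_E2 x\<close> has real part \<open>x $ 3\<close>;
  its imaginary part is \<open>side u x\<close> by definition. Multiplication by \<open>u\<close>
  undoes the rotation.\<close>

lemma proj_in_tangent_plane:
  assumes "norm u = 1" "lorentz x (null_dir u) = 0"
  shows "proj_E2 x = Complex (x $ 3) (side u x) * u"
proof -
  have "Complex (x $ 3) (side u x) = cnj u * proj_E2 x"
    using assms(2) by (simp add: complex_eq_iff lorentz_null_dir side_def)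
  then have "Complex (x $ 3) (side u x) * u = (u * cnj u) * proj_E2 x"
    by simp
  then show ?thesis
    using assms(1) by (simp add: complex_norm_square[symmetric])
qed

lemma lorentz_null_dir_self: "norm u = 1 \<Longrightarrow> lorentz (null_dir u) (null_dir u) = 0"
  by (simp add: lorentz_self proj_E2_simps)

lemma side_null_dir: "side u (null_dir u) = 0"
  by (simp add: side_def proj_E2_simps)

lemma side_linear:
  "side u (x + y) = side u x + side u y" "side u (x - y) = side u x - side u y"
  "side u (s *\<^sub>R x) = s * side u x"
  by (simp_all add: side_def proj_E2_simps algebra_simps)

lemma side_eq_zero_iff:
  assumes "norm u = 1" "lorentz (x - m) (null_dir u) = 0"
  shows "side u (x - m) = 0 \<longleftrightarrow> (\<exists>t. x = m + t *\<^sub>R null_dir u)"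
proof
  assume "side u (x - m) = 0"
  then have "proj_E2 (x - m) = proj_E2 ((x - m) $ 3 *\<^sub>R null_dir u)"
    using proj_in_tangent_plane[OF assms]
    by (simp add: proj_E2_simps complex_eq_iff)
  then have "x - m = (x - m) $ 3 *\<^sub>R null_dir u"
    by (subst vec3_eq_iff) simp
  then show "\<exists>t. x = m + t *\<^sub>R null_dir u"
    by (metis add.commute diff_add_cancel)
qed (auto simp: side_linear side_null_dir)

section \<open>Normal form of oriented isotropic lines and of oriented contact\<close>

lemma oline_shift:
  assumes "norm u = 1"
  shows "oline (m + s *\<^sub>R null_dir u) u \<epsilon> = oline m u \<epsilon>"
proof -
  have "(\<exists>t. x = m + s *\<^sub>R null_dir u + t *\<^sub>R null_dir u) \<longleftrightarrow> (\<exists>t. x = m + t *\<^sub>R null_dir u)" for x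
  proof
    assume "\<exists>t. x = m + s *\<^sub>R null_dir u + t *\<^sub>R null_dir u"
    then show "\<exists>t. x = m + t *\<^sub>R null_dir u"
      by (metis add.assoc scaleR_left_distrib)
  next
    assume "\<exists>t. x = m + t *\<^sub>R null_dir u"
    then obtain t where "x = m + t *\<^sub>R null_dir u" by blast
    then have "x = m + s *\<^sub>R null_dir u + (t - s) *\<^sub>R null_dir u"
      by (simp add: algebra_simps)
    then show "\<exists>t. x = m + s *\<^sub>R null_dir u + t *\<^sub>R null_dir u" by blast
  qed
  moreover have "lorentz (x - (m + s *\<^sub>R null_dir u)) (null_dir u) = lorentz (x - m) (null_dir u)"
    "side u (x - (m + s *\<^sub>R null_dir u)) = side u (x - m)" for x
    using assms
    by (simp_all add: lorentz_linear side_linear lorentz_null_dir_self side_null_dir diff_diff_eq[symmetric])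
  ultimately show ?thesis
    unfolding oline_def by simp
qed

text \<open>Each half-plane is convex, hence connected, so maximality of components puts one of them
  inside \<open>K\<close>. Conversely, the continuous function \<open>side u\<close> has no zero on
  the connected set \<open>K\<close>, so its sign is constant there.\<close>

lemma component_half_plane:
  fixes m :: "real ^ 3"
  assumes "norm u = 1"
    and "K \<in> components {x. lorentz (x - m) (null_dir u) = 0 \<and> side u (x - m) \<noteq> 0}"
  shows "\<exists>\<epsilon>\<in>{1,-1}. K = {x. lorentz (x - m) (null_dir u) = 0 \<and> \<epsilon> * side u (x - m) < 0}"
proof -
  define S where "S = {x. lorentz (x - m) (null_dir u) = 0 \<and> side u (x - m) \<noteq> 0}"
  define A where "A \<epsilon> = {x. lorentz (x - m) (null_dir u) = 0 \<and> \<epsilon> * side u (x - m) < 0}" for \<epsilon> :: real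
  have K: "K \<in> components S" using assms(2) by (simp add: S_def)
  then have "K \<noteq> {}" "connected K" "K \<subseteq> S"
    using in_components_nonempty in_components_connected in_components_subset by blast+
  then obtain y where y: "y \<in> K" "y \<in> S" by blast
  \<comment> \<open>The sign is read off at one point \<open>y\<close> of the component.\<close>
  define \<epsilon> :: real where "\<epsilon> = (if side u (y - m) < 0 then 1 else -1)"
  have \<epsilon>: "\<epsilon> \<in> {1,-1}" "y \<in> A \<epsilon>"
    using y(2) by (auto simp: \<epsilon>_def S_def A_def)
  have "convex (A \<epsilon>)"
  proof (rule convexI)
    fix x z :: "real ^ 3" and a b :: real
    assume h: "x \<in> A \<epsilon>" "z \<in> A \<epsilon>" "0 \<le> a" "0 \<le> b" "a + b = 1"
    have eq: "a *\<^sub>R x + b *\<^sub>R z - m = a *\<^sub>R (x - m) + b *\<^sub>R (z - m)"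
      using h(5) by (simp add: algebra_simps) (metis scaleR_left_distrib scaleR_one)
    have "a * (\<epsilon> * side u (x - m)) + b * (\<epsilon> * side u (z - m)) < 0"
      using h convex_bound_lt[of "\<epsilon> * side u (x - m)" 0 "\<epsilon> * side u (z - m)" a b]
      by (simp add: A_def)
    then have "\<epsilon> * (a * side u (x - m) + b * side u (z - m)) < 0"
      by (simp add: algebra_simps)
    then show "a *\<^sub>R x + b *\<^sub>R z \<in> A \<epsilon>"
      using h unfolding A_def eq mem_Collect_eq by (simp add: lorentz_linear side_linear)
  qed
  then have "connected (A \<epsilon>)" by (rule convex_connected)
  moreover have "A \<epsilon> \<subseteq> S" by (auto simp: A_def S_def)
  ultimately have "A \<epsilon> \<subseteq> K"
    using components_maximal[OF K] y \<epsilon> by blast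
  moreover have "K \<subseteq> A \<epsilon>"
  proof
    fix x assume x: "x \<in> K"
    have "continuous_on K (\<lambda>x. \<epsilon> * side u (x - m))"
      unfolding side_def proj_E2_def by (simp add: complex_eq_iff) (intro continuous_intros)
    then have con: "connected ((\<lambda>x. \<epsilon> * side u (x - m)) ` K)"
      using \<open>connected K\<close> by (rule connected_continuous_image)
    have "\<epsilon> * side u (x - m) < 0"
    proof (rule ccontr)
      assume "\<not> \<epsilon> * side u (x - m) < 0"
      then have "0 \<in> (\<lambda>x. \<epsilon> * side u (x - m)) ` K"
        using connectedD_interval[OF con, of "\<epsilon> * side u (y - m)" "\<epsilon> * side u (x - m)" 0]
          x y \<epsilon> by (auto simp: A_def)
      then show False
        using \<open>K \<subseteq> S\<close> \<epsilon> by (auto simp: S_def)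
    qed
    then show "x \<in> A \<epsilon>"
      using x \<open>K \<subseteq> S\<close> by (auto simp: A_def S_def)
  qed
  ultimately show ?thesis using \<epsilon> unfolding A_def by blast
qed

text \<open>Dividing the direction by its third coordinate gives \<open>null_dir u\<close>. The base
  point can be any given point of the line because \<open>oline\<close> is invariant under shifts
  along the line.\<close>

lemma oriented_isotropic_line_oline:
  assumes "oriented_isotropic_line l" "m \<in> fst l"
  shows "\<exists>u \<epsilon>. norm u = 1 \<and> \<epsilon> \<in> {1,-1} \<and> l = oline m u \<epsilon>"
proof -
  obtain q d where d: "d \<noteq> 0" "lorentz d d = 0"
    and L: "fst l = {q + t *\<^sub>R d | t. True}"
    and K: "snd l \<in> components ({x. lorentz (x - q) d = 0} - fst l)"
    using assms(1) unfolding oriented_isotropic_line_def by (elim exE conjE) simp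
  have sq: "(d $ 1)\<^sup>2 + (d $ 2)\<^sup>2 = (d $ 3)\<^sup>2"
    using d(2) by (simp add: lorentz_def power2_eq_square)
  have d3: "d $ 3 \<noteq> 0"
  proof
    assume "d $ 3 = 0"
    then have "d = 0" using sq by (simp add: vec_eq_iff forall_3)
    then show False using d by simp
  qed
  define u where "u = Complex (d $ 1 / d $ 3) (d $ 2 / d $ 3)"
  have u: "norm u = 1"
    using sq d3 by (simp add: u_def cmod_def power_divide add_divide_distrib[symmetric])
  have du: "d = d $ 3 *\<^sub>R null_dir u"
    using d3 by (subst vec_eq_iff) (simp add: forall_3 u_def)
  have du': "null_dir u = (1 / d $ 3) *\<^sub>R d"
    using d3 arg_cong[OF du, of "scaleR (1 / d $ 3)"] by simp
  obtain s where s: "m = q + s *\<^sub>R d" using assms(2) L by auto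
  have "s *\<^sub>R d = (s * d $ 3) *\<^sub>R null_dir u"
    using arg_cong[OF du, of "scaleR s"] by simp
  then have qm: "q = m + (- s * d $ 3) *\<^sub>R null_dir u"
    using s by simp
  have Lq: "fst l = fst (oline q u 1)"
  proof -
    have "(\<exists>t. x = q + t *\<^sub>R d) \<longleftrightarrow> (\<exists>t. x = q + t *\<^sub>R null_dir u)" for x
    proof
      assume "\<exists>t. x = q + t *\<^sub>R d"
      then obtain t where "x = q + t *\<^sub>R d" ..
      also have "t *\<^sub>R d = (t * d $ 3) *\<^sub>R null_dir u"
        using arg_cong[OF du, of "scaleR t"] by simp
      finally show "\<exists>t. x = q + t *\<^sub>R null_dir u" by blast
    next
      assume "\<exists>t. x = q + t *\<^sub>R null_dir u"
      then show "\<exists>t. x = q + t *\<^sub>R d"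
        unfolding du' by auto
    qed
    then show ?thesis by (simp add: L oline_def)
  qed
  then have Lm: "fst l = {m + t *\<^sub>R null_dir u | t. True}"
    unfolding qm oline_shift[OF u] by (simp add: oline_def)
  have "lorentz (x - q) d = d $ 3 * lorentz (x - m) (null_dir u)" for x
  proof -
    have "x - q = x - m + (s * d $ 3) *\<^sub>R null_dir u"
      by (simp add: qm)
    then have "lorentz (x - q) (null_dir u) = lorentz (x - m) (null_dir u)"
      by (simp only: lorentz_linear(1,3) lorentz_null_dir_self[OF u] mult_zero_right add_0_right)
    moreover have "lorentz (x - q) d = d $ 3 * lorentz (x - q) (null_dir u)"
      using arg_cong[OF du, of "lorentz (x - q)"] by (simp only: lorentz_linear(4))
    ultimately show ?thesis by simp
  qed
  then have H: "{x. lorentz (x - q) d = 0} - fst l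
      = {x. lorentz (x - m) (null_dir u) = 0 \<and> side u (x - m) \<noteq> 0}"
    using side_eq_zero_iff[OF u] d3 Lm by auto
  obtain \<epsilon> where "\<epsilon> \<in> {1,-1}"
    "snd l = {x. lorentz (x - m) (null_dir u) = 0 \<and> \<epsilon> * side u (x - m) < 0}"
    using component_half_plane[OF u K[unfolded H]] by (elim bexE)
  then show ?thesis using u Lm by (intro exI[of _ u] exI[of _ \<epsilon>]) (auto simp: oline_def prod_eq_iff)
qed

text \<open>Restricted to the line, the sphere equation is a polynomial in \<open>t\<close> without
  quadratic term, since the direction is isotropic. Its coefficients show that the center lies in
  the isotropic plane with \<open>side\<close> equal to \<open>r\<close> or \<open>-r\<close>, and
  the orientation selects the sign.\<close>

lemma contact_timelike:
  assumes "in_contact (Timelike_sphere m' r) (oline m u \<epsilon>)" "norm u = 1" "\<epsilon> \<in> {1,-1}" "r \<noteq> 0"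
  shows "proj_E2 m' - proj_E2 m = Complex (m' $ 3 - m $ 3) (\<epsilon> * r) * u"
proof -
  define x where "x = m' - m"
  have on: "lorentz (m + t *\<^sub>R null_dir u - m') (m + t *\<^sub>R null_dir u - m') = r\<^sup>2" for t
    using assms(1) by (auto simp: oline_def)
  have "lorentz (m + t *\<^sub>R null_dir u - m') (m + t *\<^sub>R null_dir u - m')
      = lorentz x x - 2 * t * lorentz x (null_dir u) + t\<^sup>2 * lorentz (null_dir u) (null_dir u)" for t
    by (simp add: x_def lorentz_def power2_eq_square algebra_simps)
  then have "lorentz x x - 2 * t * lorentz x (null_dir u) = r\<^sup>2" for t
    using on lorentz_null_dir_self[OF assms(2)] by simp
  from this[of 0] this[of 1] have x: "lorentz x x = r\<^sup>2" "lorentz x (null_dir u) = 0"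
    by simp_all
  note px = proj_in_tangent_plane[OF assms(2) x(2)]
  have "(x $ 3)\<^sup>2 + (side u x)\<^sup>2 - (x $ 3)\<^sup>2 = r\<^sup>2"
    using x(1) by (simp add: lorentz_self px norm_mult assms(2) cmod_power2)
  then have "side u x = r \<or> side u x = - r"
    by (simp add: power2_eq_iff)
  moreover have "0 < r \<longrightarrow> \<not> \<epsilon> * side u x < 0" "r < 0 \<longrightarrow> \<epsilon> * side u x < 0"
    using assms(1) x(2) by (auto simp: oline_def x_def)
  ultimately have "side u x = \<epsilon> * r"
    using assms(3,4) by auto
  then show ?thesis using px by (simp add: x_def proj_E2_simps)
qed

section \<open>The star of a vertex\<close>

definition face :: "vertex \<Rightarrow> vertex set" where
  "face z = {z, z + e1, z + e1 + e2, z + e2}"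

primrec radius :: "lsphere \<Rightarrow> real" where
  "radius (Null_sphere m) = 0"
| "radius (Timelike_sphere m r) = r"

definition height :: "lsphere \<Rightarrow> complex" where
  "height s = Complex (center s $ 3) (radius s)"

text \<open>Only signs 1 and -1 occur: identity and conjugation. This treats both line orientations
  by one formula.\<close>

definition twist :: "real \<Rightarrow> complex \<Rightarrow> complex" where
  "twist \<epsilon> t = Complex (Re t) (\<epsilon> * Im t)"

lemma twist_simps:
  "Re (twist \<epsilon> t) = Re t" "Im (twist \<epsilon> t) = \<epsilon> * Im t"
  "twist (- \<epsilon>) t = cnj (twist \<epsilon> t)" "twist 1 t = t" "twist (-1) t = cnj t"
  "twist \<epsilon> (- t) = - twist \<epsilon> t"
  by (simp_all add: twist_def complex_eq_iff)

lemma face_in_faces: "face z \<in> faces"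
  unfolding faces_def face_def by blast

lemma white_iff: "white v \<longleftrightarrow> \<not> black v"
  by (simp add: white_def black_def)

lemma black_shift:
  "black (v + e1) = (\<not> black v)" "black (v - e1) = (\<not> black v)"
  "black (v + e2) = (\<not> black v)" "black (v - e2) = (\<not> black v)"
  by (auto simp: black_def e1_def e2_def)

lemma face_neighbours:
  "v \<in> face v" "v + e1 \<in> face v" "v + e2 \<in> face v"
  "v \<in> face (v - e1)" "v + e2 \<in> face (v - e1)" "v - e1 \<in> face (v - e1)"
  "v \<in> face (v - e1 - e2)" "v - e1 \<in> face (v - e1 - e2)" "v - e2 \<in> face (v - e1 - e2)"
  "v \<in> face (v - e2)" "v + e1 \<in> face (v - e2)" "v - e2 \<in> face (v - e2)"
  by (auto simp: face_def algebra_simps)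

lemma face_share_edge:
  "share_edge (face v) (face (v - e1))" "share_edge (face v) (face (v - e2))"
proof -
  have "v + e1 \<notin> face (v - e1)" "v + e2 \<notin> face (v - e2)"
    by (cases v, simp add: face_def e1_def e2_def)+
  then have "face v \<noteq> face (v - e1)" "face v \<noteq> face (v - e2)"
    using face_neighbours by metis+
  moreover have "adjacent v (v + e2)" "adjacent v (v + e1)"
    by (simp_all add: adjacent_def)
  ultimately show "share_edge (face v) (face (v - e1))" "share_edge (face v) (face (v - e2))"
    unfolding share_edge_def using face_neighbours[of v] by blast+
qed

section \<open>Null congruences in coordinates adapted to a face\<close>

lemma null_congruence_black:
  assumes "null_congruence c cF" "black b"
  shows "c b = Null_sphere (center (c b))" "Im (height (c b)) = 0"
proof -
  have "is_null_sphere (c b)" using assms unfolding null_congruence_def by blast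
  then show "c b = Null_sphere (center (c b))" "Im (height (c b)) = 0"
    by (auto simp: is_null_sphere_def height_def)
qed

lemma null_congruence_white:
  assumes "null_congruence c cF" "white w"
  shows "c w = Timelike_sphere (center (c w)) (radius (c w))" "Im (height (c w)) \<noteq> 0"
proof -
  have "is_timelike_sphere (c w)" using assms unfolding null_congruence_def by blast
  then show "c w = Timelike_sphere (center (c w)) (radius (c w))" "Im (height (c w)) \<noteq> 0"
    by (auto simp: is_timelike_sphere_def height_def)
qed

text \<open>The centers of the black null-spheres of a face lie on its line, so any of them serves
  as base point with the same \<open>u\<close> and \<open>\<epsilon>\<close>.\<close>

lemma face_coordinates:
  assumes "null_congruence c cF"
  shows "\<exists>u \<epsilon>. norm u = 1 \<and> \<epsilon> \<in> {1,-1} \<and>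
           (\<forall>b\<in>face z. black b \<longrightarrow> cF (face z) = oline (center (c b)) u \<epsilon>)"
proof -
  have cc: "contact_congruence c cF"
    using assms unfolding null_congruence_def by blast
  have iso: "oriented_isotropic_line (cF (face z))"
    using cc face_in_faces by (simp add: contact_congruence_def)
  have on: "center (c b) \<in> fst (cF (face z))" if "b \<in> face z" "black b" for b
  proof -
    have "in_contact (Null_sphere (center (c b))) (cF (face z))"
      using cc face_in_faces that null_congruence_black(1)[OF assms that(2)]
      by (metis contact_congruence_def)
    then show ?thesis by (cases "cF (face z)") simp
  qed
  obtain b where b: "b \<in> face z" "black b"
    using face_neighbours(1,2) black_shift(1) by blast
  obtain u \<epsilon> where u: "norm u = 1" "\<epsilon> \<in> {1,-1}" "cF (face z) = oline (center (c b)) u \<epsilon>"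
    using oriented_isotropic_line_oline[OF iso on[OF b]] by blast
  have "cF (face z) = oline (center (c b')) u \<epsilon>" if b': "b' \<in> face z" "black b'" for b'
  proof -
    obtain t where "center (c b') = center (c b) + t *\<^sub>R null_dir u"
      using on[OF b'] u(3) by (auto simp: oline_def)
    then show ?thesis using u oline_shift by simp
  qed
  then show ?thesis using u by blast
qed

text \<open>From the black end to the white end this is \<open>contact_timelike\<close>; the
  reversed edge follows because \<open>twist\<close> is odd.\<close>

lemma edge_projection:
  assumes "null_congruence c cF" "norm u = 1" "\<epsilon> \<in> {1,-1}"
    and line: "\<And>b. b \<in> face z \<Longrightarrow> black b \<Longrightarrow> cF (face z) = oline (center (c b)) u \<epsilon>"
    and xy: "x \<in> face z" "y \<in> face z" "black x \<noteq> black y"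
  shows "proj_E2 (center (c y)) - proj_E2 (center (c x)) = twist \<epsilon> (height (c y) - height (c x)) * u"
proof -
  have bw: "proj_E2 (center (c w)) - proj_E2 (center (c b)) = twist \<epsilon> (height (c w) - height (c b)) * u"
    if "b \<in> face z" "w \<in> face z" "black b" "white w" for b w
  proof -
    have "in_contact (c w) (cF (face z))"
      using assms(1) face_in_faces that(2)
      by (simp add: null_congruence_def contact_congruence_def)
    then have "in_contact (Timelike_sphere (center (c w)) (radius (c w))) (oline (center (c b)) u \<epsilon>)"
      using null_congruence_white(1)[OF assms(1) that(4)] line that by metis
    moreover have "radius (c w) \<noteq> 0" "radius (c b) = 0"
      using null_congruence_white(2)[OF assms(1) that(4)] null_congruence_black(2)[OF assms(1) that(3)]
      by (simp_all add: height_def)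
    ultimately show ?thesis
      using contact_timelike[OF _ assms(2,3)] by (simp add: height_def twist_def)
  qed
  show ?thesis
  proof (cases "black x")
    case True
    then show ?thesis using bw xy white_iff by blast
  next
    case False
    then have "proj_E2 (center (c x)) - proj_E2 (center (c y)) = twist \<epsilon> (height (c x) - height (c y)) * u"
      using bw xy white_iff by blast
    moreover have "twist \<epsilon> (height (c y) - height (c x)) = - twist \<epsilon> (height (c x) - height (c y))"
      by (subst twist_simps(6)[symmetric]) simp
    ultimately show ?thesis by (simp add: algebra_simps)
  qed
qed

text \<open>Crossing an edge flips the orientation sign \<open>\<epsilon>\<close> of the isotropic line, hence conjugates
  the factor of the edge.\<close>

lemma vertex_star:
  assumes "null_congruence c cF" "nondegenerate c cF"
    and p: "\<And>v. p v = proj_E2 (center (c v))"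
    and \<tau>: "\<And>v. \<tau> v = height (c v)"
  shows "\<exists>\<epsilon> u1 u2 u3 u4. \<epsilon> \<in> {1,-1::real} \<and> norm u1 = 1 \<and> norm u2 = 1 \<and>
    p (v + e1) - p v = twist \<epsilon> (\<tau> (v + e1) - \<tau> v) * u1 \<and>
    p (v + e1) - p v = cnj (twist \<epsilon> (\<tau> (v + e1) - \<tau> v)) * u4 \<and>
    p (v + e2) - p v = twist \<epsilon> (\<tau> (v + e2) - \<tau> v) * u1 \<and>
    p (v + e2) - p v = cnj (twist \<epsilon> (\<tau> (v + e2) - \<tau> v)) * u2 \<and>
    p (v - e1) - p v = twist \<epsilon> (\<tau> (v - e1) - \<tau> v) * u3 \<and>
    p (v - e1) - p v = cnj (twist \<epsilon> (\<tau> (v - e1) - \<tau> v)) * u2 \<and>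
    p (v - e2) - p v = twist \<epsilon> (\<tau> (v - e2) - \<tau> v) * u3 \<and>
    p (v - e2) - p v = cnj (twist \<epsilon> (\<tau> (v - e2) - \<tau> v)) * u4"
proof -
  obtain U E where U: "\<And>z. norm (U z) = 1" and E: "\<And>z. E z \<in> {1,-1::real}"
    and line: "\<And>z b. b \<in> face z \<Longrightarrow> black b \<Longrightarrow> cF (face z) = oline (center (c b)) (U z) (E z)"
    using face_coordinates[OF assms(1)] by metis
  have edge: "p y - p x = twist (E z) (\<tau> y - \<tau> x) * U z"
    if "x \<in> face z" "y \<in> face z" "black x \<noteq> black y" for x y z
    unfolding p \<tau> by (rule edge_projection[OF assms(1) U E line that])
  \<comment> \<open>Exactly one end of the common edge is white, so its twisted height difference is
    nonzero. Equal signs would then force equal directions, and the two lines, based at the common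
    black center, would coincide.\<close>
  have flip: "E z' = - E z"
    if xy: "x \<in> face z" "y \<in> face z" "x \<in> face z'" "y \<in> face z'" "black x \<noteq> black y"
      and ne: "share_edge (face z) (face z')" for x y z z'
  proof (rule ccontr)
    assume "E z' \<noteq> - E z"
    then have eq: "E z' = E z" using E[of z] E[of z'] by auto
    have "Im (\<tau> y - \<tau> x) \<noteq> 0"
      using null_congruence_white(2)[OF assms(1)] null_congruence_black(2)[OF assms(1)] xy(5)
      unfolding \<tau> white_iff by (metis diff_zero minus_complex.sel(2) right_minus_eq)
    then have "twist (E z) (\<tau> y - \<tau> x) \<noteq> 0"
      using E[of z] by (auto simp: twist_def complex_eq_iff)
    then have "U z = U z'"
      using edge[OF xy(1,2,5)] edge[OF xy(3,4,5)] eq by simp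
    then have "cF (face z) = cF (face z')"
      using line eq xy by metis
    then show False
      using assms(2) ne face_in_faces by (auto simp: nondegenerate_def)
  qed
  have flip1: "E (z - e1) = - E z" for z
    using flip[of z z "z + e2" "z - e1"] face_neighbours[of z] face_share_edge black_shift by simp
  have flip2: "E (z - e2) = - E z" for z
    using flip[of z z "z + e1" "z - e2"] face_neighbours[of z] face_share_edge black_shift by simp
  have E3: "E (v - e1 - e2) = E v" by (simp add: flip1 flip2)
  note fn = face_neighbours[of v] and bs = black_shift[of v]
  show ?thesis
    \<comment> \<open>The witnesses are the directions of the four faces around \<open>v\<close>,
      counterclockwise from the upper right one. Diagonally opposite faces have the same sign,
      adjacent ones opposite signs.\<close>
    apply (rule exI[of _ "E v"], rule exI[of _ "U v"], rule exI[of _ "U (v - e1)"],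
        rule exI[of _ "U (v - e1 - e2)"], rule exI[of _ "U (v - e2)"])
    using E U edge[of v v "v + e1"] edge[of v "v - e2" "v + e1"] edge[of v v "v + e2"]
      edge[of v "v - e1" "v + e2"] edge[of v "v - e1 - e2" "v - e1"] edge[of v "v - e1" "v - e1"]
      edge[of v "v - e1 - e2" "v - e2"] edge[of v "v - e2" "v - e2"]
    unfolding flip1 flip2 E3 twist_simps(3) minus_minus
    by (simp add: fn bs)
qed

text \<open>Each of the face pairs \<open>u1\<close>, \<open>u3\<close> and \<open>u2\<close>,
  \<open>u4\<close> covers all four edges, so its factors cancel in the quotient. One pair gives
  \<open>X\<close> in terms of the \<open>t\<close>, the other the same with conjugates; hence
  \<open>X\<close> is real. The third relation prepares a linear dependence of the four
  spokes.\<close>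

lemma star_relations:
  fixes t1 t2 t3 t4 :: complex
  assumes z: "z1 = t1 * u1" "z1 = cnj t1 * u4" "z2 = t2 * u1" "z2 = cnj t2 * u2"
    "z3 = t3 * u3" "z3 = cnj t3 * u2" "z4 = t4 * u3" "z4 = cnj t4 * u4"
    and nz: "z2 \<noteq> 0" "z4 \<noteq> 0" and X: "X = - (z1 * z3 / (z2 * z4))"
  shows "X \<in> \<real>" "t1 * t3 + X * (t2 * t4) = 0"
    "of_real (Im t3) * z1 + of_real (Im t1) * z3
       + X * (of_real (Im t4) * z2 + of_real (Im t2) * z4) = 0"
proof -
  have ne: "t2 \<noteq> 0" "t4 \<noteq> 0" "u1 \<noteq> 0" "u2 \<noteq> 0" "u3 \<noteq> 0" "u4 \<noteq> 0"
    using z nz by auto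
  have "z1 * z3 / (z2 * z4) = (t1 * u1) * (t3 * u3) / ((t2 * u1) * (t4 * u3))"
    using z by metis
  then have X1: "X = - (t1 * t3 / (t2 * t4))"
    using ne by (simp add: X field_simps)
  have "z1 * z3 / (z2 * z4) = (cnj t1 * u4) * (cnj t3 * u2) / ((cnj t2 * u2) * (cnj t4 * u4))"
    using z by metis
  then have "X = - (cnj t1 * cnj t3 / (cnj t2 * cnj t4))"
    using ne by (simp add: X field_simps)
  then have cX: "cnj X = X" using X1 by simp
  then show "X \<in> \<real>" by (simp add: Reals_cnj_iff)
  show rel: "t1 * t3 + X * (t2 * t4) = 0"
    using ne by (simp add: X1)
  then have rel': "cnj t1 * cnj t3 + X * (cnj t2 * cnj t4) = 0"
    using cX by (metis complex_cnj_add complex_cnj_mult complex_cnj_zero)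
  have I: "2 * \<i> * of_real (Im t) = t - cnj t" for t
    by (simp add: complex_eq_iff)
  \<comment> \<open>In each of the four products, the two terms of \<open>t - cnj t\<close> are
    expanded with the two different faces at the edge. Only \<open>t1 * t3\<close>,
    \<open>t2 * t4\<close> and their conjugates then appear, and these satisfy \<open>rel\<close>
    and \<open>rel'\<close>.\<close>
  have a: "(t3 - cnj t3) * z1 = (t1 * t3) * u1 - (cnj t1 * cnj t3) * u4"
  proof -
    have "(t3 - cnj t3) * z1 = t3 * z1 - cnj t3 * z1" by (simp add: algebra_simps)
    also have "\<dots> = t3 * (t1 * u1) - cnj t3 * (cnj t1 * u4)" using z(1,2) by metis
    finally show ?thesis by (simp add: algebra_simps)
  qed
  have b: "(t1 - cnj t1) * z3 = (t1 * t3) * u3 - (cnj t1 * cnj t3) * u2"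
  proof -
    have "(t1 - cnj t1) * z3 = t1 * z3 - cnj t1 * z3" by (simp add: algebra_simps)
    also have "\<dots> = t1 * (t3 * u3) - cnj t1 * (cnj t3 * u2)" using z(5,6) by metis
    finally show ?thesis by (simp add: algebra_simps)
  qed
  have c: "(t4 - cnj t4) * z2 = (t2 * t4) * u1 - (cnj t2 * cnj t4) * u2"
  proof -
    have "(t4 - cnj t4) * z2 = t4 * z2 - cnj t4 * z2" by (simp add: algebra_simps)
    also have "\<dots> = t4 * (t2 * u1) - cnj t4 * (cnj t2 * u2)" using z(3,4) by metis
    finally show ?thesis by (simp add: algebra_simps)
  qed
  have d: "(t2 - cnj t2) * z4 = (t2 * t4) * u3 - (cnj t2 * cnj t4) * u4"
  proof -
    have "(t2 - cnj t2) * z4 = t2 * z4 - cnj t2 * z4" by (simp add: algebra_simps)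
    also have "\<dots> = t2 * (t4 * u3) - cnj t2 * (cnj t4 * u4)" using z(7,8) by metis
    finally show ?thesis by (simp add: algebra_simps)
  qed
  have "2 * \<i> * (of_real (Im t3) * z1 + of_real (Im t1) * z3
       + X * (of_real (Im t4) * z2 + of_real (Im t2) * z4))
     = (2 * \<i> * of_real (Im t3)) * z1 + (2 * \<i> * of_real (Im t1)) * z3
       + X * ((2 * \<i> * of_real (Im t4)) * z2 + (2 * \<i> * of_real (Im t2)) * z4)"
    by (simp add: algebra_simps)
  also have "\<dots> = (t1 * t3 + X * (t2 * t4)) * (u1 + u3)
      - (cnj t1 * cnj t3 + X * (cnj t2 * cnj t4)) * (u2 + u4)"
    unfolding I a b c d by (simp add: algebra_simps)
  also have "\<dots> = 0" unfolding rel rel' by simp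
  finally show "of_real (Im t3) * z1 + of_real (Im t1) * z3
       + X * (of_real (Im t4) * z2 + of_real (Im t2) * z4) = 0"
    by simp
qed

section \<open>The isothermic condition\<close>

text \<open>The direction space has codimension one, so it is the kernel of a Euclidean normal
  \<open>n\<close>; positive definiteness excludes nonzero isotropic vectors from it.\<close>

lemma spacelike_plane_normal:
  assumes "spacelike_plane P"
  shows "\<exists>n k. (\<forall>x\<in>P. n \<bullet> x = k) \<and> (\<forall>x. n \<bullet> x = 0 \<longrightarrow> lorentz x x = 0 \<longrightarrow> x = 0)"
proof -
  obtain q V where V: "subspace V" "dim V = 2" "P = (\<lambda>x. q + x) ` V"
    "\<And>x. x \<in> V \<Longrightarrow> x \<noteq> 0 \<Longrightarrow> 0 < lorentz x x"
    using assms unfolding spacelike_plane_def by blast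
  have "dim V = DIM(real ^ 3) - 1" using V(2) by simp
  then obtain n where "span V = {x. n \<bullet> x = 0}"
    using dim_eq_hyperplane by blast
  then have n: "V = {x. n \<bullet> x = 0}"
    using V(1) by (metis span_eq_iff)
  show ?thesis
  proof (intro exI conjI)
    show "\<forall>x\<in>P. n \<bullet> x = n \<bullet> q"
      using V(3) n by (auto simp: inner_add_right)
    show "\<forall>x. n \<bullet> x = 0 \<longrightarrow> lorentz x x = 0 \<longrightarrow> x = 0"
      using V(4) n by force
  qed
qed

text \<open>The combination cancels the imaginary parts of the factors of \<open>u\<close>, which
  leaves a real multiple of \<open>null_dir u\<close>.\<close>

lemma null_combination:
  assumes "proj_E2 x = t * u" "proj_E2 y = s * u" "x $ 3 = Re t" "y $ 3 = Re s" "norm u = 1"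
  shows "lorentz (Im s *\<^sub>R x - Im t *\<^sub>R y) (Im s *\<^sub>R x - Im t *\<^sub>R y) = 0"
proof -
  have "proj_E2 (Im s *\<^sub>R x - Im t *\<^sub>R y) = of_real (Im s * Re t - Im t * Re s) * u"
    by (simp add: proj_E2_simps assms complex_eq_iff algebra_simps)
  then show ?thesis
    by (simp add: lorentz_self assms norm_mult del: of_real_diff of_real_mult)
qed

text \<open>The four spokes from the black center satisfy a linear dependence with the radii as
  coefficients. The normal of the spacelike plane takes one nonzero value \<open>h\<close> on all
  spokes, so pairing it with the dependence leaves the sum of the coefficients.\<close>

lemma isothermic_radii:
  assumes "isothermic_congruence c cF" "nondegenerate c cF" "black b"
    and p: "\<And>v. p v = proj_E2 (center (c v))"
    and \<tau>: "\<And>v. \<tau> v = height (c v)"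
    and X: "X = - (((p (b + e1) - p b) * (p (b - e1) - p b)) / ((p (b + e2) - p b) * (p (b - e2) - p b)))"
  shows "Im (\<tau> (b + e1)) + Im (\<tau> (b - e1)) + Re X * (Im (\<tau> (b + e2)) + Im (\<tau> (b - e2))) = 0"
proof -
  have nc: "null_congruence c cF" using assms(1) by (simp add: isothermic_congruence_def)
  obtain \<epsilon> u1 u2 u3 u4 where \<epsilon>: "\<epsilon> \<in> {1,-1::real}" and u: "norm u1 = 1" "norm u2 = 1"
    and star: "p (b + e1) - p b = twist \<epsilon> (\<tau> (b + e1) - \<tau> b) * u1"
    "p (b + e1) - p b = cnj (twist \<epsilon> (\<tau> (b + e1) - \<tau> b)) * u4"
    "p (b + e2) - p b = twist \<epsilon> (\<tau> (b + e2) - \<tau> b) * u1"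
    "p (b + e2) - p b = cnj (twist \<epsilon> (\<tau> (b + e2) - \<tau> b)) * u2"
    "p (b - e1) - p b = twist \<epsilon> (\<tau> (b - e1) - \<tau> b) * u3"
    "p (b - e1) - p b = cnj (twist \<epsilon> (\<tau> (b - e1) - \<tau> b)) * u2"
    "p (b - e2) - p b = twist \<epsilon> (\<tau> (b - e2) - \<tau> b) * u3"
    "p (b - e2) - p b = cnj (twist \<epsilon> (\<tau> (b - e2) - \<tau> b)) * u4"
    using vertex_star[OF nc assms(2) p \<tau>, of b] by blast
  define t where "t v = twist \<epsilon> (\<tau> v - \<tau> b)" for v
  define x where "x v = center (c v) - center (c b)" for v
  have px: "proj_E2 (x v) = p v - p b" for v by (simp add: x_def p proj_E2_simps)
  have x3: "x v $ 3 = Re (t v)" for v by (simp add: x_def t_def twist_simps \<tau> height_def)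
  have "adjacent b (b + e2)" "adjacent b (b - e2)" by (simp_all add: adjacent_def)
  then have nz: "p (b + e2) - p b \<noteq> 0" "p (b - e2) - p b \<noteq> 0"
    using assms(2) unfolding nondegenerate_def p by (metis eq_iff_diff_eq_0)+
  note rel = star_relations[OF star[folded t_def] nz X]
  have Xr: "X = of_real (Re X)" using rel(1) by simp
  have "Im (t (b + e1) * t (b - e1) + X * (t (b + e2) * t (b - e2))) = 0"
    using rel(2) by simp
  then have im: "Im (t (b - e1)) * Re (t (b + e1)) + Im (t (b + e1)) * Re (t (b - e1))
      + Re X * (Im (t (b - e2)) * Re (t (b + e2)) + Im (t (b + e2)) * Re (t (b - e2))) = 0"
    by (subst (asm) Xr) (simp add: algebra_simps)
  \<comment> \<open>The projection to the plane is the third star relation; the third coordinate is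
    the imaginary part of the second one.\<close>
  have dep: "Im (t (b - e1)) *\<^sub>R x (b + e1) + Im (t (b + e1)) *\<^sub>R x (b - e1)
      + Re X *\<^sub>R (Im (t (b - e2)) *\<^sub>R x (b + e2) + Im (t (b + e2)) *\<^sub>R x (b - e2)) = 0"
    (is "?S = 0")
  proof -
    have "proj_E2 ?S = 0"
      using rel(3) by (subst (asm) Xr) (simp add: proj_E2_simps px, simp add: scaleR_conv_of_real)
    moreover have "?S $ 3 = 0" using im by (simp add: x3)
    ultimately show ?thesis by (subst vec3_eq_iff) (simp add: proj_E2_def complex_eq_iff)
  qed
  obtain P where P: "spacelike_plane P" "{center (c (b + e1)), center (c (b + e2)),
              center (c (b - e1)), center (c (b - e2))} \<subseteq> P"
    using assms(1,3) unfolding isothermic_congruence_def by blast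
  obtain n k where n: "\<And>x. x \<in> P \<Longrightarrow> n \<bullet> x = k"
    and null: "\<And>x. n \<bullet> x = 0 \<Longrightarrow> lorentz x x = 0 \<Longrightarrow> x = 0"
    using spacelike_plane_normal[OF P(1)] by blast
  define h where "h = k - n \<bullet> center (c b)"
  have nx: "n \<bullet> x (b + e1) = h" "n \<bullet> x (b + e2) = h" "n \<bullet> x (b - e1) = h" "n \<bullet> x (b - e2) = h"
    using n P(2) by (simp_all add: x_def h_def inner_diff_right)
  have solve: "y = (\<beta> / \<alpha>) *\<^sub>R z" if "\<alpha> *\<^sub>R y - \<beta> *\<^sub>R z = 0" "\<alpha> \<noteq> 0" for \<alpha> \<beta> and y z :: "real ^ 3"
  proof -
    have "y = inverse \<alpha> *\<^sub>R (\<alpha> *\<^sub>R y)" using that(2) by simp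
    also have "\<alpha> *\<^sub>R y = \<beta> *\<^sub>R z" using that by simp
    finally show ?thesis by (simp only: scaleR_scaleR divide_inverse mult.commute)
  qed
  \<comment> \<open>If the spacelike plane met the center of \<open>c b\<close>, neighbouring spokes would differ by a null vector
    of the plane after rescaling, so all spokes would be parallel.\<close>
  have "h \<noteq> 0"
  proof
    assume h0: "h = 0"
    have "white (b + e2)" using assms(3) by (simp add: white_iff black_shift)
    then have r: "Im (t (b + e2)) \<noteq> 0"
      using null_congruence_white(2)[OF nc] null_congruence_black(2)[OF nc assms(3)] \<epsilon>
      by (auto simp: t_def twist_simps \<tau>)
    have "Im (t (b + e2)) *\<^sub>R x (b + e1) - Im (t (b + e1)) *\<^sub>R x (b + e2) = 0"
      using nx h0 star(1,3) u(1)
      by (intro null null_combination[where u = u1]) (simp_all add: inner_diff_right px x3 t_def)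
    then have "x (b + e1) = (Im (t (b + e1)) / Im (t (b + e2))) *\<^sub>R x (b + e2)"
      using r by (rule solve)
    moreover
    \<comment> \<open>These two spokes share the face with direction \<open>u2\<close>, where the
      factors are conjugated.\<close>
    have "Im (cnj (t (b + e2))) *\<^sub>R x (b - e1) - Im (cnj (t (b - e1))) *\<^sub>R x (b + e2) = 0"
      using nx h0 star(4,6) u(2)
      by (intro null null_combination[where u = u2]) (simp_all add: inner_diff_right px x3 t_def)
    then have "x (b - e1) = (Im (t (b - e1)) / Im (t (b + e2))) *\<^sub>R x (b + e2)"
      using r by (intro solve) simp_all
    ultimately obtain \<alpha> \<beta> where x13: "x (b + e1) = \<alpha> *\<^sub>R x (b + e2)" "x (b - e1) = \<beta> *\<^sub>R x (b + e2)"
      by blast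
    have "collinear {center (c (b + e1)), center (c (b + e2)), center (c (b - e1))}"
      unfolding collinear_alt
    proof (rule exI[of _ "center (c b)"], rule exI[of _ "x (b + e2)"], rule ballI)
      fix y assume "y \<in> {center (c (b + e1)), center (c (b + e2)), center (c (b - e1))}"
      then have "y - center (c b) \<in> {x (b + e1), x (b + e2), x (b - e1)}"
        by (auto simp: x_def)
      then have "\<exists>a. y - center (c b) = a *\<^sub>R x (b + e2)"
        using x13 by (metis empty_iff insert_iff scaleR_one)
      then show "\<exists>a. y = center (c b) + a *\<^sub>R x (b + e2)"
        by (metis add.commute diff_add_cancel)
    qed
    then show False using assms(2,3) unfolding nondegenerate_def by blast
  qed
  moreover have "n \<bullet> ?S = h * (Im (t (b - e1)) + Im (t (b + e1)) + Re X * (Im (t (b - e2)) + Im (t (b + e2))))"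
    by (simp add: inner_add_right nx) (simp add: algebra_simps)
  ultimately have "Im (t (b - e1)) + Im (t (b + e1)) + Re X * (Im (t (b - e2)) + Im (t (b + e2))) = 0"
    using dep by simp
  moreover have "Im (\<tau> b) = 0" using null_congruence_black(2)[OF nc assms(3)] by (simp add: \<tau>)
  ultimately have "\<epsilon> * (Im (\<tau> (b + e1)) + Im (\<tau> (b - e1)) + Re X * (Im (\<tau> (b + e2)) + Im (\<tau> (b - e2)))) = 0"
    by (simp add: t_def twist_simps algebra_simps)
  then show ?thesis using \<epsilon> by auto
qed

section \<open>Product formulas from quadratic polynomials\<close>

text \<open>A real polynomial with a nonreal root also has the conjugate root. Subtracting the two
  root equations and dividing by \<open>\<tau> - cnj \<tau>\<close> gives the sum of the
  roots.\<close>

lemma real_quadratic_factor: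
  fixes a1 a2 a3 a4 X \<tau> T :: complex
  assumes real: "a1 \<in> \<real>" "a2 \<in> \<real>" "a3 \<in> \<real>" "a4 \<in> \<real>" "X \<in> \<real>"
    and root: "(\<tau> - a1) * (\<tau> - a3) + X * ((\<tau> - a2) * (\<tau> - a4)) = 0"
    and "Im \<tau> \<noteq> 0"
  shows "(T - a1) * (T - a3) + X * ((T - a2) * (T - a4)) = (1 + X) * ((T - \<tau>) * (T - cnj \<tau>))"
proof -
  have cnj: "cnj a1 = a1" "cnj a2 = a2" "cnj a3 = a3" "cnj a4 = a4" "cnj X = X"
    using real by (simp_all add: Reals_cnj_iff)
  have root': "(cnj \<tau> - a1) * (cnj \<tau> - a3) + X * ((cnj \<tau> - a2) * (cnj \<tau> - a4)) = 0"
    using arg_cong[OF root, of cnj] by (simp add: cnj)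
  have "(\<tau> - cnj \<tau>) * ((1 + X) * (\<tau> + cnj \<tau>) - (a1 + a3 + X * (a2 + a4)))
      = ((\<tau> - a1) * (\<tau> - a3) + X * ((\<tau> - a2) * (\<tau> - a4)))
        - ((cnj \<tau> - a1) * (cnj \<tau> - a3) + X * ((cnj \<tau> - a2) * (cnj \<tau> - a4)))"
    by (simp add: algebra_simps)
  also have "\<dots> = 0" unfolding root root' by simp
  finally have S: "(1 + X) * (\<tau> + cnj \<tau>) - (a1 + a3 + X * (a2 + a4)) = 0"
    using \<open>Im \<tau> \<noteq> 0\<close> by (auto simp: complex_eq_iff)
  have "(T - a1) * (T - a3) + X * ((T - a2) * (T - a4)) - (1 + X) * ((T - \<tau>) * (T - cnj \<tau>))
      = (T - \<tau>) * ((1 + X) * (\<tau> + cnj \<tau>) - (a1 + a3 + X * (a2 + a4)))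
        + ((\<tau> - a1) * (\<tau> - a3) + X * ((\<tau> - a2) * (\<tau> - a4)))"
    by (simp add: algebra_simps)
  also have "\<dots> = 0" unfolding S root by simp
  finally show ?thesis by simp
qed

text \<open>Vieta: the numerator of \<open>s'\<close> is minus the linear coefficient, and
  \<open>1 + X\<close> is the leading one.\<close>

lemma quadratic_second_root:
  fixes a1 a2 a3 a4 X s :: "'a::field"
  assumes root: "(a1 - s) * (a3 - s) + X * ((a2 - s) * (a4 - s)) = 0" and "1 + X \<noteq> 0"
  defines "s' \<equiv> (a1 + a3 + X * (a2 + a4)) / (1 + X) - s"
  shows "(T - a1) * (T - a3) + X * ((T - a2) * (T - a4)) = (1 + X) * ((T - s) * (T - s'))"
proof -
  have S: "a1 + a3 + X * (a2 + a4) = (1 + X) * (s + s')"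
    using assms(2) by (simp add: s'_def)
  have "(T - a1) * (T - a3) + X * ((T - a2) * (T - a4))
      = (T - s) * ((1 + X) * (T + s) - (a1 + a3 + X * (a2 + a4)))
        + ((a1 - s) * (a3 - s) + X * ((a2 - s) * (a4 - s)))"
    by (simp add: algebra_simps)
  also have "\<dots> = (T - s) * ((1 + X) * (T + s) - (1 + X) * (s + s'))"
    unfolding S root by simp
  also have "\<dots> = (1 + X) * ((T - s) * (T - s'))"
    by (simp add: algebra_simps)
  finally show ?thesis .
qed

text \<open>\<open>A\<close>, \<open>B\<close>, \<open>C\<close>, \<open>D\<close> belong to the
  diagonal neighbours of a vertex. Each occurs once in the numerator and once in the denominator,
  hence cancels.\<close>

lemma cyclic_product_ratio:
  fixes A B C D n s e w xN xS xE xW :: "'a::field"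
  assumes "A * B = (1 + xN) * n" "C * D = (1 + xS) * s"
    and "xE * (A * D) = (1 + xE) * e" "xW * (B * C) = (1 + xW) * w"
    and nz: "n \<noteq> 0" "s \<noteq> 0" "e \<noteq> 0" "w \<noteq> 0" "xE \<noteq> 0" "xW \<noteq> 0"
    "1 + xN \<noteq> 0" "1 + xS \<noteq> 0" "1 + xE \<noteq> 0" "1 + xW \<noteq> 0"
  shows "((1 + xN) * (1 + xS)) / ((1 + inverse xE) * (1 + inverse xW)) = (e * w) / (n * s)"
proof -
  have "A * B \<noteq> 0" "C * D \<noteq> 0" using assms by auto
  then have ne: "A \<noteq> 0" "B \<noteq> 0" "C \<noteq> 0" "D \<noteq> 0" by auto
  have "1 + xN = A * B / n" "1 + xS = C * D / s" "1 + inverse xE = A * D / e" "1 + inverse xW = B * C / w"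
    using assms by (simp_all add: field_simps)
  then show ?thesis
    using ne nz(1-4) by (simp only:) (simp add: field_simps)
qed

text \<open>Stated for general \<open>\<sigma>\<close> and \<open>Z\<close> because it is applied
  twice: to \<open>\<tau>\<close> with the X-variables and to the second roots with the
  Y-variables.\<close>

lemma black_product_formula:
  fixes \<sigma> \<tau> Z :: "vertex \<Rightarrow> complex"
  assumes "black b"
    and \<sigma>: "\<And>v. black v \<Longrightarrow> \<sigma> v \<in> \<real>"
    and Z: "\<And>w. white w \<Longrightarrow> Z w \<in> \<real>" "\<And>w. white w \<Longrightarrow> 0 < Re (Z w)"
    and \<tau>: "\<And>w. white w \<Longrightarrow> Im (\<tau> w) \<noteq> 0"
    and root: "\<And>w. white w \<Longrightarrow> (\<tau> w - \<sigma> (w + e1)) * (\<tau> w - \<sigma> (w - e1))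
                 + Z w * ((\<tau> w - \<sigma> (w + e2)) * (\<tau> w - \<sigma> (w - e2))) = 0"
    and "X \<in> \<real>"
    and X: "(\<tau> (b + e1) - \<sigma> b) * (\<tau> (b - e1) - \<sigma> b)
                 + X * ((\<tau> (b + e2) - \<sigma> b) * (\<tau> (b - e2) - \<sigma> b)) = 0"
  shows "X\<^sup>2 = ((1 + Z (b + e2)) * (1 + Z (b - e2))) /
                 ((1 + inverse (Z (b + e1))) * (1 + inverse (Z (b - e1))))"
proof -
  define s where "s = \<sigma> b"
  define N where "N w = (s - \<tau> w) * (s - cnj (\<tau> w))" for w
  have fac: "(s - \<sigma> (w + e1)) * (s - \<sigma> (w - e1)) + Z w * ((s - \<sigma> (w + e2)) * (s - \<sigma> (w - e2)))
      = (1 + Z w) * N w" if "white w" for w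
    unfolding N_def using that
    by (intro real_quadratic_factor \<sigma> Z root \<tau>) (simp_all add: white_iff black_shift)
  have cs: "cnj s = s" using \<sigma>[OF assms(1)] by (simp add: s_def Reals_cnj_iff)
  have N0: "N w \<noteq> 0" if "white w" for w
  proof -
    have "Im s = 0" using \<sigma>[OF assms(1)] by (simp add: s_def complex_is_Real_iff)
    then show ?thesis using \<tau>[OF that] by (auto simp: N_def)
  qed
  have Z0: "Z w \<noteq> 0" "1 + Z w \<noteq> 0" if "white w" for w
    using Z(2)[OF that] by (auto simp: complex_eq_iff)
  have w: "white (b + e1)" "white (b - e1)" "white (b + e2)" "white (b - e2)"
    using assms(1) by (simp_all add: white_iff black_shift)
  \<comment> \<open>The vertex \<open>b\<close> is itself a neighbour of each of the four white
    \<open>w\<close>, so one product in \<open>fac\<close> vanishes and the other contains two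
    corner factors.\<close>
  define A B C D where "A = s - \<sigma> (b + e1 + e2)" and "B = s - \<sigma> (b - e1 + e2)"
    and "C = s - \<sigma> (b - e1 - e2)" and "D = s - \<sigma> (b + e1 - e2)"
  have comm: "b + e2 + e1 = b + e1 + e2" "b + e2 - e1 = b - e1 + e2"
    "b - e2 - e1 = b - e1 - e2" "b - e2 + e1 = b + e1 - e2"
    by (simp_all add: algebra_simps)
  have "((1 + Z (b + e2)) * (1 + Z (b - e2))) / ((1 + inverse (Z (b + e1))) * (1 + inverse (Z (b - e1))))
      = (N (b + e1) * N (b - e1)) / (N (b + e2) * N (b - e2))"
  proof (rule cyclic_product_ratio)
    show "A * B = (1 + Z (b + e2)) * N (b + e2)"
      using fac[OF w(3)] by (simp add: comm A_def B_def s_def[symmetric])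
    show "C * D = (1 + Z (b - e2)) * N (b - e2)"
      using fac[OF w(4)] by (simp add: comm C_def D_def s_def[symmetric] mult.commute)
    show "Z (b + e1) * (A * D) = (1 + Z (b + e1)) * N (b + e1)"
      using fac[OF w(1)] by (simp add: A_def D_def s_def[symmetric])
    show "Z (b - e1) * (B * C) = (1 + Z (b - e1)) * N (b - e1)"
      using fac[OF w(2)] by (simp add: B_def C_def s_def[symmetric])
  qed (use w N0 Z0 in auto)
  also have "\<dots> = X\<^sup>2"
  proof -
    \<comment> \<open>As \<open>s\<close> is real, \<open>N w\<close> is the squared modulus of
      \<open>t w\<close>. Multiplying the relation for \<open>X\<close> by its conjugate therefore
      yields the square of \<open>X\<close>.\<close>
    define t where "t w = \<tau> w - s" for w
    have N: "N w = t w * cnj (t w)" for w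
      by (simp add: N_def t_def cs algebra_simps)
    have X1: "t (b + e1) * t (b - e1) = - X * (t (b + e2) * t (b - e2))"
      using X by (simp add: t_def s_def eq_neg_iff_add_eq_0)
    have X2: "cnj (t (b + e1)) * cnj (t (b - e1)) = - X * (cnj (t (b + e2)) * cnj (t (b - e2)))"
      using arg_cong[OF X1, of cnj] \<open>X \<in> \<real>\<close> by (simp add: Reals_cnj_iff)
    have "N (b + e1) * N (b - e1) = (t (b + e1) * t (b - e1)) * (cnj (t (b + e1)) * cnj (t (b - e1)))"
      by (simp add: N mult_ac)
    also have "\<dots> = X\<^sup>2 * (N (b + e2) * N (b - e2))"
      unfolding X1 X2 by (simp add: N power2_eq_square mult_ac)
    finally show ?thesis using N0 w by simp
  qed
  finally show ?thesis by simp
qed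

text \<open>The black quadratics are evaluated at \<open>\<tau> w\<close> and the corner factors
  cancel. Of the remaining factors, those with \<open>H\<close> have quotient \<open>- X w\<close>,
  which cancels the prefactor of \<open>Y\<close> up to sign; those with \<open>\<sigma>\<close>
  then have quotient \<open>- Y\<close>.\<close>

lemma white_dual_relation:
  fixes \<sigma> H \<tau> X :: "vertex \<Rightarrow> complex"
  assumes "white w"
    and factor: "\<And>b T. black b \<Longrightarrow> (T - \<tau> (b + e1)) * (T - \<tau> (b - e1))
        + X b * ((T - \<tau> (b + e2)) * (T - \<tau> (b - e2))) = (1 + X b) * ((T - H b) * (T - \<sigma> b))"
    and X0: "\<And>v. X v \<noteq> 0" "\<And>v. 1 + X v \<noteq> 0"
    and ne: "\<And>b. black b \<Longrightarrow> \<tau> w \<noteq> H b" "\<And>b. black b \<Longrightarrow> \<tau> w \<noteq> \<sigma> b"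
    and root: "(\<tau> w - H (w + e1)) * (\<tau> w - H (w - e1))
                 + X w * ((\<tau> w - H (w + e2)) * (\<tau> w - H (w - e2))) = 0"
    and Y: "Y = inverse (X w) *
             (((1 + X (w + e2)) * (1 + X (w - e2))) /
              ((1 + inverse (X (w + e1))) * (1 + inverse (X (w - e1)))))"
  shows "(\<tau> w - \<sigma> (w + e1)) * (\<tau> w - \<sigma> (w - e1))
                 + Y * ((\<tau> w - \<sigma> (w + e2)) * (\<tau> w - \<sigma> (w - e2))) = 0"
proof -
  define s where "s = \<tau> w"
  define h k where "h b = s - H b" and "k b = s - \<sigma> b" for b
  have b: "black (w + e1)" "black (w - e1)" "black (w + e2)" "black (w - e2)"
    using assms(1) by (simp_all add: white_iff black_shift)
  have h0: "h b \<noteq> 0" "k b \<noteq> 0" if "black b" for b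
    using ne[OF that] by (simp_all add: h_def k_def s_def)
  define A B C D where "A = s - \<tau> (w + e1 + e2)" and "B = s - \<tau> (w - e1 + e2)"
    and "C = s - \<tau> (w - e1 - e2)" and "D = s - \<tau> (w + e1 - e2)"
  have comm: "w + e2 + e1 = w + e1 + e2" "w + e2 - e1 = w - e1 + e2"
    "w - e2 - e1 = w - e1 - e2" "w - e2 + e1 = w + e1 - e2"
    by (simp_all add: algebra_simps)
  have "((1 + X (w + e2)) * (1 + X (w - e2))) / ((1 + inverse (X (w + e1))) * (1 + inverse (X (w - e1))))
      = ((h (w + e1) * k (w + e1)) * (h (w - e1) * k (w - e1))) /
        ((h (w + e2) * k (w + e2)) * (h (w - e2) * k (w - e2)))"
  proof (rule cyclic_product_ratio)
    show "A * B = (1 + X (w + e2)) * (h (w + e2) * k (w + e2))"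
      using factor[OF b(3), of s] by (simp add: comm A_def B_def s_def[symmetric] h_def k_def)
    show "C * D = (1 + X (w - e2)) * (h (w - e2) * k (w - e2))"
      using factor[OF b(4), of s]
      by (simp add: comm C_def D_def s_def[symmetric] h_def k_def mult.commute[of "_ - \<tau> (w - e1 - e2)"])
    show "X (w + e1) * (A * D) = (1 + X (w + e1)) * (h (w + e1) * k (w + e1))"
      using factor[OF b(1), of s] by (simp add: A_def D_def s_def[symmetric] h_def k_def)
    show "X (w - e1) * (B * C) = (1 + X (w - e1)) * (h (w - e1) * k (w - e1))"
      using factor[OF b(2), of s] by (simp add: B_def C_def s_def[symmetric] h_def k_def)
  qed (use b h0 X0 in auto)
  then have "Y = inverse (X w) * (((h (w + e1) * h (w - e1)) * (k (w + e1) * k (w - e1))) /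
        ((h (w + e2) * h (w - e2)) * (k (w + e2) * k (w - e2))))"
    unfolding Y by (simp add: mult_ac)
  moreover have "h (w + e1) * h (w - e1) = - X w * (h (w + e2) * h (w - e2))"
    using root by (simp add: h_def s_def eq_neg_iff_add_eq_0)
  moreover have "inverse x * ((- x * q * m) / (q * n)) = - m / n" if "x \<noteq> 0" "q \<noteq> 0" for x q m n :: complex
    using that by simp
  ultimately have "Y = - (k (w + e1) * k (w - e1)) / (k (w + e2) * k (w - e2))"
    using X0(1)[of w] h0(1)[OF b(3)] h0(1)[OF b(4)] by (metis no_zero_divisors)
  then have "k (w + e1) * k (w - e1) + Y * (k (w + e2) * k (w - e2)) = 0"
    using h0 b by simp
  then show ?thesis by (simp add: k_def s_def)
qed

text \<open>The star relation holds for the twisted differences; for \<open>\<epsilon> = -1\<close>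
  conjugation removes the twist, as \<open>X\<close> is real.\<close>

lemma X_relation:
  assumes "null_congruence c cF" "nondegenerate c cF"
    and p: "\<And>v. p v = proj_E2 (center (c v))"
    and \<tau>: "\<And>v. \<tau> v = height (c v)"
    and X: "X = - (((p (v + e1) - p v) * (p (v - e1) - p v)) / ((p (v + e2) - p v) * (p (v - e2) - p v)))"
  shows "X \<in> \<real>"
    "(\<tau> (v + e1) - \<tau> v) * (\<tau> (v - e1) - \<tau> v) + X * ((\<tau> (v + e2) - \<tau> v) * (\<tau> (v - e2) - \<tau> v)) = 0"
proof -
  obtain \<epsilon> u1 u2 u3 u4 where \<epsilon>: "\<epsilon> \<in> {1,-1::real}"
    and star: "p (v + e1) - p v = twist \<epsilon> (\<tau> (v + e1) - \<tau> v) * u1"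
    "p (v + e1) - p v = cnj (twist \<epsilon> (\<tau> (v + e1) - \<tau> v)) * u4"
    "p (v + e2) - p v = twist \<epsilon> (\<tau> (v + e2) - \<tau> v) * u1"
    "p (v + e2) - p v = cnj (twist \<epsilon> (\<tau> (v + e2) - \<tau> v)) * u2"
    "p (v - e1) - p v = twist \<epsilon> (\<tau> (v - e1) - \<tau> v) * u3"
    "p (v - e1) - p v = cnj (twist \<epsilon> (\<tau> (v - e1) - \<tau> v)) * u2"
    "p (v - e2) - p v = twist \<epsilon> (\<tau> (v - e2) - \<tau> v) * u3"
    "p (v - e2) - p v = cnj (twist \<epsilon> (\<tau> (v - e2) - \<tau> v)) * u4"
    using vertex_star[OF assms(1,2) p \<tau>, of v] by blast
  have "adjacent v (v + e2)" "adjacent v (v - e2)" by (simp_all add: adjacent_def)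
  then have nz: "p (v + e2) - p v \<noteq> 0" "p (v - e2) - p v \<noteq> 0"
    using assms(2) unfolding nondegenerate_def p by (metis eq_iff_diff_eq_0)+
  note rel = star_relations[OF star nz X]
  show "X \<in> \<real>" by (rule rel(1))
  show "(\<tau> (v + e1) - \<tau> v) * (\<tau> (v - e1) - \<tau> v) + X * ((\<tau> (v + e2) - \<tau> v) * (\<tau> (v - e2) - \<tau> v)) = 0"
  proof (cases "\<epsilon> = 1")
    case True
    then show ?thesis using rel(2) by (simp add: twist_simps)
  next
    case False
    then have "\<epsilon> = -1" using \<epsilon> by simp
    then show ?thesis
      using arg_cong[OF rel(2), of cnj] rel(1) by (simp add: twist_simps Reals_cnj_iff)
  qed
qed

section \<open>The two product formulas\<close>

theorem theorem11p4:
  fixes c :: "vertex \<Rightarrow> lsphere" and cF :: "vertex set \<Rightarrow> oriented_line"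
    and p X Y :: "vertex \<Rightarrow> complex"
  assumes "isothermic_congruence c cF"
    and "nondegenerate c cF"
    and "\<And>v. p v = proj_E2 (center (c v))"
    and "\<And>v. X v = - (((p (v + e1) - p v) * (p (v - e1) - p v)) /
                        ((p (v + e2) - p v) * (p (v - e2) - p v)))"
    and "\<And>v. 0 < Re (X v)"
    and "\<And>w. white w \<Longrightarrow>
           Y w = inverse (X w) *
             (((1 + X (w + e2)) * (1 + X (w - e2))) /
              ((1 + inverse (X (w + e1))) * (1 + inverse (X (w - e1)))))"
  shows "(\<forall>v. X v \<in> \<real>) \<and>
    (\<forall>b. black b \<longrightarrow>
       (X b)\<^sup>2 = ((1 + X (b + e2)) * (1 + X (b - e2))) /
                 ((1 + inverse (X (b + e1))) * (1 + inverse (X (b - e1)))) \<and>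
       (X b)\<^sup>2 = ((1 + Y (b + e2)) * (1 + Y (b - e2))) /
                 ((1 + inverse (Y (b + e1))) * (1 + inverse (Y (b - e1)))))"
proof -
  have nc: "null_congruence c cF" using assms(1) by (simp add: isothermic_congruence_def)
  define \<tau> where "\<tau> v = height (c v)" for v
  note X_rel = X_relation[OF nc assms(2,3) \<tau>_def assms(4)]
  have Im_\<tau>: "Im (\<tau> b) = 0" if "black b" for b
    using null_congruence_black(2)[OF nc that] by (simp add: \<tau>_def)
  then have \<tau>_black: "\<tau> b \<in> \<real>" if "black b" for b
    using that by (simp add: complex_is_Real_iff)
  have \<tau>_white: "Im (\<tau> w) \<noteq> 0" if "white w" for w
    using null_congruence_white(2)[OF nc that] by (simp add: \<tau>_def)
  have X0: "X v \<noteq> 0" "1 + X v \<noteq> 0" for v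
    using assms(5)[of v] by (auto simp: complex_eq_iff)
  have root: "(\<tau> w - \<tau> (w + e1)) * (\<tau> w - \<tau> (w - e1))
      + X w * ((\<tau> w - \<tau> (w + e2)) * (\<tau> w - \<tau> (w - e2))) = 0" for w
    using X_rel(2)[of w] by (simp add: algebra_simps)
  define \<sigma> where "\<sigma> b = (\<tau> (b + e1) + \<tau> (b - e1) + X b * (\<tau> (b + e2) + \<tau> (b - e2))) / (1 + X b) - \<tau> b" for b
  have factor: "(T - \<tau> (b + e1)) * (T - \<tau> (b - e1)) + X b * ((T - \<tau> (b + e2)) * (T - \<tau> (b - e2)))
      = (1 + X b) * ((T - \<tau> b) * (T - \<sigma> b))" for b T
    unfolding \<sigma>_def using X_rel(2) X0(2) by (rule quadratic_second_root)
  \<comment> \<open>The numerator in \<open>\<sigma>\<close> is real by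
    \<open>isothermic_radii\<close>; this is where the isothermic condition enters.\<close>
  have \<sigma>_real: "\<sigma> b \<in> \<real>" if "black b" for b
  proof -
    have "X b = of_real (Re (X b))" using X_rel(1) by simp
    then have "Im (\<tau> (b + e1) + \<tau> (b - e1) + X b * (\<tau> (b + e2) + \<tau> (b - e2))) = 0"
      using isothermic_radii[OF assms(1,2) that assms(3) \<tau>_def assms(4)]
      by (metis Im_complex_of_real add.right_neutral mult_zero_left plus_complex.sel(2) times_complex.sel(2))
    then have "\<tau> (b + e1) + \<tau> (b - e1) + X b * (\<tau> (b + e2) + \<tau> (b - e2)) \<in> \<real>"
      by (simp only: complex_is_Real_iff)
    then show ?thesis
      unfolding \<sigma>_def using \<tau>_black that X_rel(1) by (intro Reals_diff Reals_divide) auto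
  qed
  have \<sigma>_root: "(\<tau> (b + e1) - \<sigma> b) * (\<tau> (b - e1) - \<sigma> b)
      + X b * ((\<tau> (b + e2) - \<sigma> b) * (\<tau> (b - e2) - \<sigma> b)) = 0" for b
    using factor[of "\<sigma> b" b] by (simp add: algebra_simps)
  have Y_root: "(\<tau> w - \<sigma> (w + e1)) * (\<tau> w - \<sigma> (w - e1))
      + Y w * ((\<tau> w - \<sigma> (w + e2)) * (\<tau> w - \<sigma> (w - e2))) = 0" if "white w" for w
    using that factor X0 _ _ root assms(6)[OF that]
  proof (rule white_dual_relation)
    show "\<tau> w \<noteq> \<tau> b" "\<tau> w \<noteq> \<sigma> b" if "black b" for b
      using \<tau>_white[OF \<open>white w\<close>] Im_\<tau>[OF that] \<sigma>_real[OF that] by (auto simp: complex_is_Real_iff)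
  qed
  \<comment> \<open>All X-variables are positive reals, so the formula for \<open>Y w\<close> can be
    evaluated in the reals.\<close>
  have Y: "Y w \<in> \<real>" "0 < Re (Y w)" if "white w" for w
  proof -
    define x where "x v = Re (X v)" for v
    have X: "X v = of_real (x v)" for v using X_rel(1) by (simp add: x_def)
    have x: "0 < x v" for v using assms(5) by (simp add: x_def)
    define y where "y = inverse (x w) * (((1 + x (w + e2)) * (1 + x (w - e2))) /
              ((1 + inverse (x (w + e1))) * (1 + inverse (x (w - e1)))))"
    have "Y w = of_real y"
      unfolding assms(6)[OF that] X y_def by simp
    moreover have "0 < y"
      unfolding y_def
      by (intro mult_pos_pos divide_pos_pos add_pos_pos positive_imp_inverse_positive x zero_less_one)
    ultimately show "Y w \<in> \<real>" "0 < Re (Y w)" by simp_all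
  qed
  \<comment> \<open>Both applications use the same white \<open>\<tau>\<close> and the same
    \<open>X b\<close>: \<open>\<tau> b\<close> and \<open>\<sigma> b\<close> are roots of the same
    black quadratic.\<close>
  show ?thesis
    using black_product_formula[OF _ \<tau>_black X_rel(1) assms(5) \<tau>_white root X_rel(1,2)]
      black_product_formula[OF _ \<sigma>_real Y \<tau>_white Y_root X_rel(1) \<sigma>_root] X_rel(1)
    by blast
qed

end
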